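(* Let $d \geq 3$, let $q$ be a prime power, and let $r$ be either $r = 2\frac{q^d-1}{q-1}$ or $r = \binom{d}{1}_q + \binom{d}{2}_q + \cdots + \binom{d}{d-1}_q$. Then for every $m \in \mathbb{N}$ there exist $m$ finite $r$-regular graphs which are pairwise isospectral and pairwise non-isomorphic.
   Context: Two finite graphs are isospectral if their adjacency matrices have the same multiset of eigenvalues. $\binom{d}{i}_q$ denotes the number of $i$-dimensional $\mathbb{F}_q$-subspaces of $\mathbb{F}_q^d$. *)

theory Defs
  imports
    Complex_Main
    "HOL-Number_Theory.Prime_Powers"
    "Graph_Theory.Graph_Theory"
    "Jordan_Normal_Form.Char_Poly"
    "Jordan_Normal_Form.Missing_VectorSpace"
begin

text \<open>
  Finite simple graphs are the loop-free symmetric finite digraphs \<^const>\<open>pair_graph\<close>.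
  Arcs come in both directions, so the degree of a vertex is its out-degree.
\<close>

definition regular_graph :: "nat \<Rightarrow> 'a pair_pre_digraph \<Rightarrow> bool" where
  "regular_graph r G \<longleftrightarrow>
     pair_graph G \<and> pverts G \<noteq> {} \<and> (\<forall>v\<in>pverts G. out_degree (with_proj G) v = r)"

text \<open>
  Rows and columns follow the increasing enumeration of the vertices; any other enumeration
  conjugates the matrix by a permutation matrix.
\<close>

definition adjacency_matrix :: "'a::linorder pair_pre_digraph \<Rightarrow> complex mat" where
  "adjacency_matrix G =
     (let vs = sorted_list_of_set (pverts G)
      in mat (length vs) (length vs) (\<lambda>(i, j). if (vs ! i, vs ! j) \<in> parcs G then 1 else 0))"

text \<open>
  Over \<^typ>\<open>complex\<close> the characteristic polynomial splits, so its multiset of roots consists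
  of all eigenvalues with their (algebraic) multiplicities.
\<close>

definition eigenvalue_mset :: "complex mat \<Rightarrow> complex multiset" where
  "eigenvalue_mset A = proots (char_poly A)"

definition isospectral :: "'a::linorder pair_pre_digraph \<Rightarrow> 'b::linorder pair_pre_digraph \<Rightarrow> bool" where
  "isospectral G H \<longleftrightarrow>
     eigenvalue_mset (adjacency_matrix G) = eigenvalue_mset (adjacency_matrix H)"

definition isomorphic :: "'a pair_pre_digraph \<Rightarrow> 'b pair_pre_digraph \<Rightarrow> bool" where
  "isomorphic G H \<longleftrightarrow> digraph_iso (with_proj G) (with_proj H)"

definition coordinate_space :: "'k ring \<Rightarrow> nat \<Rightarrow> ('k, nat \<Rightarrow> 'k) module" where
  "coordinate_space F d = ring.func_space F {..<d}"

text \<open>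
  The Gaussian binomial coefficient: the number of \<open>i\<close>-dimensional subspaces of \<open>F\<^sup>d\<close>. It depends
  on the finite field \<open>F\<close> only through the order \<open>q\<close> of \<open>F\<close>.
\<close>

definition gaussian_binomial :: "'k ring \<Rightarrow> nat \<Rightarrow> nat \<Rightarrow> nat" where
  "gaussian_binomial F d i =
     card {W. VectorSpace.subspace F W (coordinate_space F d) \<and>
              vectorspace.dim F ((coordinate_space F d)\<lparr>carrier := W\<rparr>) = i}"

end

theory Submission
  imports Defs
begin

text \<open>
  The graphs are not required to be connected, so one pair of connected, isospectral, non-isomorphic
  \<open>r\<close>-regular graphs suffices: take \<open>i\<close> copies of one and \<open>m - i\<close> copies of the other. For every
  \<open>r \<ge> 6\<close> the Cartesian products of the complete graph on \<open>r - 5\<close> vertices with the \<open>4 \<times> 4\<close> rook's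
  graph and with the Shrikhande graph form such a pair. They are isospectral by Godsil--McKay
  switching along the diagonals of the boards. In the former product every neighbourhood is a disjoint
  union of cliques, while in the latter none is, so counting the vertices whose neighbourhood contains
  an induced path on three vertices recovers \<open>i\<close>. Both degrees in question are at least \<open>6\<close>;
  for the sum of Gaussian binomials, the nonzero \<open>0/1\<close>-vectors already span \<open>2\<^sup>d - 1\<close> distinct lines.
\<close>

section \<open>Graphs on an initial segment of the naturals\<close>

text \<open>Pulling a relation back along an enumeration \<open>f\<close> makes the vertices
  naturals already in increasing order, so entry \<open>(i, j)\<close> of the adjacency matrix
  depends on \<open>f i\<close> and \<open>f j\<close> alone.\<close>

definition nat_graph :: "(nat \<Rightarrow> 'a) \<Rightarrow> nat \<Rightarrow> ('a \<Rightarrow> 'a \<Rightarrow> bool) \<Rightarrow> nat pair_pre_digraph" where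
  "nat_graph f n E =
     \<lparr>pverts = {..<n}, parcs = {(v, w). v < n \<and> w < n \<and> E (f v) (f w)}\<rparr>"

lemma pverts_nat_graph [simp]: "pverts (nat_graph f n E) = {..<n}"
  by (simp add: nat_graph_def)

lemma parcs_nat_graph [simp]:
  "(v, w) \<in> parcs (nat_graph f n E) \<longleftrightarrow> v < n \<and> w < n \<and> E (f v) (f w)"
  by (simp add: nat_graph_def)

lemma card_preimage_bij_betw:
  assumes "bij_betw f A B"
  shows "card {v \<in> A. P (f v)} = card {x \<in> B. P x}"
proof (rule bij_betw_same_card)
  show "bij_betw f {v \<in> A. P (f v)} {x \<in> B. P x}"
    using assms by (auto simp: bij_betw_def inj_on_def)
qed

lemma regular_nat_graph:
  assumes f: "bij_betw f {..<n} X" and "X \<noteq> {}"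
    and sym: "\<And>x y. x \<in> X \<Longrightarrow> y \<in> X \<Longrightarrow> E x y \<Longrightarrow> E y x"
    and irrefl: "\<And>x. x \<in> X \<Longrightarrow> \<not> E x x"
    and deg: "\<And>x. x \<in> X \<Longrightarrow> card {y \<in> X. E x y} = r"
  shows "regular_graph r (nat_graph f n E)"
proof -
  let ?G = "nat_graph f n E"
  have fX: "f v \<in> X" if "v < n" for v
    using f that by (auto simp: bij_betw_def)
  have "parcs ?G \<subseteq> {..<n} \<times> {..<n}"
    by (auto simp: nat_graph_def)
  then have fin: "finite (parcs ?G)"
    by (rule finite_subset) simp
  have "symmetric (with_proj ?G)"
    using sym fX by (auto simp: symmetric_def intro!: symI)
  moreover have "fst e \<noteq> snd e" if "e \<in> parcs ?G" for e
    using that irrefl fX by (cases e) auto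
  ultimately have "pair_graph ?G"
    using fin by unfold_locales (auto simp: nat_graph_def)
  moreover have "n > 0"
    using f \<open>X \<noteq> {}\<close> by (cases n) (auto simp: bij_betw_def)
  moreover have "out_degree (with_proj ?G) v = r" if v: "v < n" for v
  proof -
    have "out_arcs (with_proj ?G) v = Pair v ` {w \<in> {..<n}. E (f v) (f w)}"
      using v by (auto simp: out_arcs_def nat_graph_def)
    then have "out_degree (with_proj ?G) v = card {w \<in> {..<n}. E (f v) (f w)}"
      by (simp add: out_degree_def card_image inj_on_def)
    also have "\<dots> = card {y \<in> X. E (f v) y}"
      by (rule card_preimage_bij_betw[OF f])
    finally show ?thesis
      using deg fX[OF v] by simp
  qed
  ultimately show ?thesis
    by (auto simp: regular_graph_def)
qed

lemma adjacency_nat_graph: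
  "adjacency_matrix (nat_graph f n E) = mat n n (\<lambda>(i, j). of_bool (E (f i) (f j)))"
  unfolding adjacency_matrix_def Let_def pverts_nat_graph lessThan_atLeast0 sorted_list_of_set_range
  by (rule eq_matI) auto


section \<open>Godsil--McKay switching\<close>

text \<open>
  The involution \<open>Q\<close> that is \<open>J / h - I\<close> on each cell of size \<open>2 h\<close> and the identity off the cells
  conjugates one adjacency matrix to the other.
\<close>

lemma godsil_mckay_isospectral:
  fixes cell :: "'a \<Rightarrow> 'a set" and h :: nat
  assumes f: "bij_betw f {..<n} X"
    and "D \<subseteq> X" "h > 0"
    and cell_sub: "\<And>x. x \<in> D \<Longrightarrow> cell x \<subseteq> D"
    and cell_eq: "\<And>x y. x \<in> D \<Longrightarrow> y \<in> D \<Longrightarrow> y \<in> cell x \<longleftrightarrow> cell y = cell x"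
    and card_cell: "\<And>x. x \<in> D \<Longrightarrow> card (cell x) = 2 * h"
    and symE: "\<And>x y. x \<in> X \<Longrightarrow> y \<in> X \<Longrightarrow> E x y \<longleftrightarrow> E y x"
    and symF: "\<And>x y. x \<in> X \<Longrightarrow> y \<in> X \<Longrightarrow> F x y \<longleftrightarrow> F y x"
    and agree: "\<And>x y. x \<in> X \<Longrightarrow> y \<in> X \<Longrightarrow> x \<in> D \<longleftrightarrow> y \<in> D \<Longrightarrow> E x y \<longleftrightarrow> F x y"
    and switch: "\<And>x y. x \<in> D \<Longrightarrow> y \<in> X - D \<Longrightarrow>
      card {u \<in> cell x. E u y} = h * (of_bool (E x y) + of_bool (F x y))"
    and biregular: "\<And>x y. x \<in> D \<Longrightarrow> y \<in> D \<Longrightarrow>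
      card {u \<in> cell x. E u y} = card {u \<in> cell y. E u x}"
  shows "isospectral (nat_graph f n E) (nat_graph f n F)"
proof -
  define Q :: "'a \<Rightarrow> 'a \<Rightarrow> complex" where
    "Q x y = (if x \<in> D then of_bool (y \<in> cell x) / of_nat h - of_bool (x = y) else of_bool (x = y))"
    for x y
  define a b :: "'a \<Rightarrow> 'a \<Rightarrow> complex" where "a x y = of_bool (E x y)" and "b x y = of_bool (F x y)"
    for x y
  have finX: "finite X"
    using f bij_betw_finite by blast
  have cell_fin: "finite (cell x)" if "x \<in> D" for x
    using finX \<open>D \<subseteq> X\<close> cell_sub[OF that] by (meson finite_subset)
  have cell_sym: "y \<in> cell x \<longleftrightarrow> x \<in> cell y" if "x \<in> D" "y \<in> D" for x y
    using cell_eq that by metis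
  have Q_sym: "Q x y = Q y x" for x y
    using cell_sym cell_sub by (auto simp: Q_def)
  \<comment> \<open>On a cell, \<open>Q\<close> reflects \<open>g\<close> in its average: the sum
    over \<open>2 * h\<close> points divided by \<open>h\<close> is twice the average. Hence
    \<open>Q\<close> is an involution, as \<open>QQ\<close> verifies.\<close>
  have Q_sum: "(\<Sum>u\<in>X. Q x u * g u) =
      (if x \<in> D then (\<Sum>u\<in>cell x. g u) / of_nat h - g x else g x)"
    if x: "x \<in> X" for x and g :: "'a \<Rightarrow> complex"
  proof (cases "x \<in> D")
    case True
    have "(\<Sum>u\<in>X. Q x u * g u) =
        (\<Sum>u\<in>X. of_bool (u \<in> cell x) * g u) / of_nat h - (\<Sum>u\<in>X. of_bool (x = u) * g u)"
      using True by (simp add: Q_def algebra_simps sum_subtractf sum_divide_distrib)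
    also have "(\<Sum>u\<in>X. of_bool (u \<in> cell x) * g u) = (\<Sum>u\<in>cell x. g u)"
      using finX \<open>D \<subseteq> X\<close> cell_sub[OF True] by (intro sum.mono_neutral_cong_right) auto
    also have "(\<Sum>u\<in>X. of_bool (x = u) * g u) = g x"
      using x finX by (simp add: sum.remove[of X x] sum.neutral)
    finally show ?thesis
      using True by simp
  next
    case False
    then have "(\<Sum>u\<in>X. Q x u * g u) = (\<Sum>u\<in>X. if x = u then g u else 0)"
      by (intro sum.cong) (auto simp: Q_def)
    then show ?thesis
      using False x finX by simp
  qed
  have h0: "of_nat h \<noteq> (0 :: complex)"
    using \<open>h > 0\<close> by simp
  have QQ: "(\<Sum>u\<in>X. Q x u * Q u z) = of_bool (x = z)" if x: "x \<in> X" and z: "z \<in> X" for x z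
  proof (cases "x \<in> D")
    case True
    have "(\<Sum>u\<in>cell x. Q u z) = (\<Sum>u\<in>cell x. of_bool (z \<in> cell x) / of_nat h - of_bool (z = u))"
    proof (intro sum.cong refl)
      fix u assume "u \<in> cell x"
      then have "u \<in> D" "cell u = cell x"
        using True cell_sub cell_eq by blast+
      then show "Q u z = of_bool (z \<in> cell x) / of_nat h - of_bool (z = u)"
        by (auto simp: Q_def)
    qed
    also have "\<dots> = 2 * of_bool (z \<in> cell x) - of_bool (z \<in> cell x)"
    proof -
      have "(\<Sum>u\<in>cell x. of_bool (z = u)) = (of_bool (z \<in> cell x) :: complex)"
        using cell_fin[OF True] by (simp add: of_bool_def)
      then show ?thesis
        using card_cell[OF True] h0 by (simp add: sum_subtractf)
    qed
    finally have "(\<Sum>u\<in>cell x. Q u z) = of_bool (z \<in> cell x)"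
      by simp
    then have "(\<Sum>u\<in>X. Q x u * Q u z) = of_bool (z \<in> cell x) / of_nat h - Q x z"
      using True x by (simp add: Q_sum)
    then show ?thesis
      using True by (simp add: Q_def)
  next
    case False
    then have "(\<Sum>u\<in>X. Q x u * Q u z) = Q x z"
      using x by (simp add: Q_sum)
    then show ?thesis
      using False by (simp add: Q_def)
  qed
  have sum_of_bool: "(\<Sum>u\<in>cell x. of_bool (R u)) = (of_nat (card {u \<in> cell x. R u}) :: complex)"
    if "x \<in> D" for x R
    using cell_fin[OF that] by (simp add: of_bool_def sum.If_cases Int_def)
  \<comment> \<open>This is the matrix identity \<open>P * A = B * P\<close> entry by entry, split
    by which of the two indices lie in \<open>D\<close>.\<close>
  have QA: "(\<Sum>u\<in>X. Q x u * a u y) = (\<Sum>u\<in>X. b x u * Q u y)" if x: "x \<in> X" and y: "y \<in> X" for x y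
  proof -
    \<comment> \<open>Symmetry of \<open>Q\<close> and \<open>b\<close> turns right multiplication
      into left multiplication, so \<open>Q_sum\<close> evaluates both sides.\<close>
    have "(\<Sum>u\<in>X. b x u * Q u y) = (\<Sum>u\<in>X. Q y u * b u x)"
      using symF x by (intro sum.cong refl) (auto simp: b_def Q_sym[of _ y])
    then have R: "(\<Sum>u\<in>X. b x u * Q u y) =
        (if y \<in> D then of_nat (card {u \<in> cell y. F u x}) / of_nat h - b y x else b y x)"
      using y by (simp add: Q_sum b_def sum_of_bool)
    have L: "(\<Sum>u\<in>X. Q x u * a u y) =
        (if x \<in> D then of_nat (card {u \<in> cell x. E u y}) / of_nat h - a x y else a x y)"
      using x by (simp add: Q_sum a_def sum_of_bool)
    have b_sym: "b y x = b x y"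
      using symF x y by (auto simp: b_def)
    consider "x \<notin> D" "y \<notin> D" | "x \<in> D" "y \<in> D" | "x \<in> D" "y \<notin> D" | "x \<notin> D" "y \<in> D"
      by blast
    then show ?thesis
    proof cases
      case 1
      then show ?thesis
        unfolding L R b_sym using agree x y by (auto simp: a_def b_def)
    next
      case 2
      \<comment> \<open>Within \<open>D\<close> the two relations agree, so only the edge counts
        into the two cells have to match; this is \<open>biregular\<close>.\<close>
      have "{u \<in> cell y. F u x} = {u \<in> cell y. E u x}"
        using agree 2 \<open>D \<subseteq> X\<close> cell_sub[OF 2(2)] by blast
      then show ?thesis
        unfolding L R b_sym using biregular[OF 2] agree x y 2 by (auto simp: a_def b_def)
    next
      case 3
      \<comment> \<open>\<open>switch\<close> merges the three cases of the method: counts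
        \<open>0\<close> and \<open>2 * h\<close> keep the adjacency to \<open>y\<close>, count
        \<open>h\<close> reverses it. Dividing by \<open>h\<close> and subtracting
        \<open>a x y\<close> leaves \<open>b x y\<close>.\<close>
      have "of_nat (card {u \<in> cell x. E u y}) = of_nat h * (a x y + b x y)"
        using switch 3 y by (simp add: a_def b_def)
      then show ?thesis
        unfolding L R b_sym using h0 3 by simp
    next
      case 4
      \<comment> \<open>\<^prop>\<open>E u x\<close> and \<^prop>\<open>F u x\<close> together hold \<open>s \<in> {0, 1, 2}\<close> times for each \<open>u\<close> in the cell,
         with the same \<open>s\<close>, so the cell sends \<open>s h\<close> edges to \<open>x\<close> in either graph.\<close>
      have each: "of_nat h * (of_bool (E u x) + of_bool (F u x)) =
          (of_nat (card {u \<in> cell y. E u x}) :: complex)" if u: "u \<in> cell y" for u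
      proof -
        have "u \<in> D" "cell u = cell y"
          using u 4 cell_sub cell_eq by blast+
        then show ?thesis
          using switch[of u x] 4 x by simp
      qed
      have "of_nat h * (of_nat (card {u \<in> cell y. E u x}) + of_nat (card {u \<in> cell y. F u x})) =
          (\<Sum>u\<in>cell y. of_nat h * (of_bool (E u x) + of_bool (F u x)) :: complex)"
        using 4 by (simp add: sum_of_bool sum.distrib flip: sum_distrib_left)
      also have "\<dots> = of_nat h * (2 * of_nat (card {u \<in> cell y. E u x}))"
        using each card_cell[OF 4(2)] by simp
      finally have "of_nat (card {u \<in> cell y. F u x}) = (of_nat (card {u \<in> cell y. E u x}) :: complex)"
        using h0 by simp
      also have "\<dots> = of_nat h * (a y x + b y x)"
        using switch 4 x by (simp add: a_def b_def)
      finally show ?thesis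
        unfolding L R using h0 4 symE x y by (simp add: a_def)
    qed
  qed
  have reindex: "(\<Sum>k = 0..<n. g (f k)) = (\<Sum>u\<in>X. g u)" for g :: "'a \<Rightarrow> complex"
    using sum.reindex_bij_betw[OF f, of g] by (simp add: lessThan_atLeast0)
  have fX: "f i \<in> X" if "i < n" for i
    using f that by (auto simp: bij_betw_def)
  have f_inj: "f i = f j \<longleftrightarrow> i = j" if "i < n" "j < n" for i j
    using f that by (auto simp: bij_betw_def inj_on_def)
  define A B P :: "complex mat" where
    "A = mat n n (\<lambda>(i, j). a (f i) (f j))" and
    "B = mat n n (\<lambda>(i, j). b (f i) (f j))" and
    "P = mat n n (\<lambda>(i, j). Q (f i) (f j))"
  have [simp]: "A \<in> carrier_mat n n" "B \<in> carrier_mat n n" "P \<in> carrier_mat n n"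
    by (auto simp: A_def B_def P_def)
  have PP: "P * P = 1\<^sub>m n"
    by (rule eq_matI)
      (auto simp: P_def scalar_prod_def reindex[of "\<lambda>u. Q _ u * Q u _"] QQ fX f_inj)
  have PA: "P * A = B * P"
    by (rule eq_matI)
      (auto simp: A_def B_def P_def scalar_prod_def reindex[of "\<lambda>u. Q _ u * a u _"]
        reindex[of "\<lambda>u. b _ u * Q u _"] QA fX)
  have "P * B * P = P * (P * A)"
    by (simp add: PA assoc_mult_mat[of _ n n _ n _ n])
  also have "\<dots> = A"
    by (simp add: PP left_mult_one_mat[of _ n n] flip: assoc_mult_mat[of _ n n _ n _ n])
  finally have "similar_mat A B"
    by (intro similar_matI[of A B P P n]) (auto simp: PP)
  then have "char_poly A = char_poly B"
    by (rule char_poly_similar)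
  moreover have "adjacency_matrix (nat_graph f n E) = A" "adjacency_matrix (nat_graph f n F) = B"
    by (simp_all add: adjacency_nat_graph A_def B_def a_def b_def)
  ultimately show ?thesis
    by (simp add: isospectral_def eigenvalue_mset_def)
qed


section \<open>Counting the hubs of induced diamonds\<close>

text \<open>For a simple graph, a diamond is the complete graph on four vertices minus the edge
  \<open>x z\<close>; \<open>v\<close> and \<open>y\<close> are its two vertices of degree
  three.\<close>

definition diamond_hubs :: "'a set \<Rightarrow> ('a \<Rightarrow> 'a \<Rightarrow> bool) \<Rightarrow> 'a set" where
  "diamond_hubs X E = {v \<in> X. \<exists>x\<in>X. \<exists>y\<in>X. \<exists>z\<in>X.
     E v x \<and> E v y \<and> E v z \<and> E x y \<and> E y z \<and> x \<noteq> z \<and> \<not> E x z}"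

lemma diamond_hubsI:
  assumes "v \<in> X" "x \<in> X" "y \<in> X" "z \<in> X"
    and "E v x" "E v y" "E v z" "E x y" "E y z" "x \<noteq> z" "\<not> E x z"
  shows "v \<in> diamond_hubs X E"
  using assms unfolding diamond_hubs_def by blast

lemma card_diamond_hubs_bij_betw:
  assumes f: "bij_betw f X Y" and E: "\<And>x y. x \<in> X \<Longrightarrow> y \<in> X \<Longrightarrow> E x y \<longleftrightarrow> F (f x) (f y)"
  shows "card (diamond_hubs X E) = card (diamond_hubs Y F)"
proof -
  have inj: "f x = f y \<longleftrightarrow> x = y" if "x \<in> X" "y \<in> X" for x y
    using f that by (auto simp: bij_betw_def inj_on_def)
  have Y: "Y = f ` X"
    using f by (simp add: bij_betw_def)
  have "diamond_hubs X E = {v \<in> X. f v \<in> diamond_hubs Y F}"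
    unfolding diamond_hubs_def Y
    by (rule Collect_cong) (simp add: E inj cong: conj_cong bex_cong)
  also have "card \<dots> = card {v \<in> Y. v \<in> diamond_hubs Y F}"
    by (rule card_preimage_bij_betw[OF f])
  also have "{v \<in> Y. v \<in> diamond_hubs Y F} = diamond_hubs Y F"
    by (auto simp: diamond_hubs_def)
  finally show ?thesis .
qed

text \<open>Library isomorphisms map vertices and arcs separately. As tail and head are
  \<open>fst\<close> and \<open>snd\<close> on both sides, the vertex map determines the arc
  map.\<close>

lemma isomorphic_bij_betw:
  assumes "isomorphic G H" "parcs G \<subseteq> pverts G \<times> pverts G"
  obtains g where "bij_betw g (pverts G) (pverts H)"
    "\<And>v w. v \<in> pverts G \<Longrightarrow> w \<in> pverts G \<Longrightarrow> (v, w) \<in> parcs G \<longleftrightarrow> (g v, g w) \<in> parcs H"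
proof -
  obtain iso where iso: "pre_digraph.digraph_isomorphism (with_proj G) iso"
    and H: "with_proj H = app_iso iso (with_proj G)"
    using assms(1) by (auto simp: isomorphic_def digraph_iso_def)
  define g where "g = iso_verts iso"
  have inj: "inj_on g (pverts G)"
    using iso by (simp add: pre_digraph.digraph_isomorphism_def g_def)
  have verts: "pverts H = g ` pverts G" and arcs: "parcs H = iso_arcs iso ` parcs G"
    and ends: "iso_tail iso = fst" "iso_head iso = snd"
    using arg_cong[OF H, of verts] arg_cong[OF H, of arcs] arg_cong[OF H, of tail]
      arg_cong[OF H, of head] by (auto simp: g_def)
  have "iso_arcs iso e = map_prod g g e" if "e \<in> parcs G" for e
    using iso that unfolding pre_digraph.digraph_isomorphism_def
    by (auto simp: g_def ends prod_eq_iff)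
  then have parcs: "parcs H = map_prod g g ` parcs G"
    using arcs by (metis (no_types, lifting) image_cong)
  show ?thesis
  proof
    show "bij_betw g (pverts G) (pverts H)"
      using inj verts by (simp add: bij_betw_def)
    show "(v, w) \<in> parcs G \<longleftrightarrow> (g v, g w) \<in> parcs H"
      if "v \<in> pverts G" "w \<in> pverts G" for v w
    proof
      assume "(g v, g w) \<in> parcs H"
      \<comment> \<open>The preimage arc might a priori have other ends; they are vertices by the
        second assumption, so injectivity identifies them with \<open>v\<close> and
        \<open>w\<close>.\<close>
      then obtain v' w' where vw: "(v', w') \<in> parcs G" "g v' = g v" "g w' = g w"
        unfolding parcs by auto
      moreover from this have "v' \<in> pverts G" "w' \<in> pverts G"
        using assms(2) by auto
      ultimately show "(v, w) \<in> parcs G"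
        using that inj by (metis inj_onD)
    qed (auto simp: parcs)
  qed
qed

lemma isomorphic_nat_graph_card_diamond_hubs:
  assumes f: "bij_betw f {..<n} X" and iso: "isomorphic (nat_graph f n E) (nat_graph f n F)"
  shows "card (diamond_hubs X E) = card (diamond_hubs X F)"
proof -
  obtain g where g: "bij_betw g {..<n} {..<n}"
    and arcs: "\<And>v w. v < n \<Longrightarrow> w < n \<Longrightarrow> E (f v) (f w) \<longleftrightarrow> F (f (g v)) (f (g w))"
  proof (rule isomorphic_bij_betw[OF iso])
    show "parcs (nat_graph f n E) \<subseteq> pverts (nat_graph f n E) \<times> pverts (nat_graph f n E)"
      by (auto simp: nat_graph_def)
  next
    fix g
    assume g: "bij_betw g (pverts (nat_graph f n E)) (pverts (nat_graph f n F))"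
      and "\<And>v w. v \<in> pverts (nat_graph f n E) \<Longrightarrow> w \<in> pverts (nat_graph f n E) \<Longrightarrow>
        (v, w) \<in> parcs (nat_graph f n E) \<longleftrightarrow> (g v, g w) \<in> parcs (nat_graph f n F)"
    moreover have "g v < n" if "v < n" for v
      using g that by (auto simp: bij_betw_def)
    ultimately show thesis
      by (intro that[of g]) auto
  qed
  have "card (diamond_hubs X E) = card (diamond_hubs {..<n} (\<lambda>v w. E (f v) (f w)))"
    by (rule card_diamond_hubs_bij_betw[OF f, symmetric]) simp
  also have "\<dots> = card (diamond_hubs X F)"
    by (rule card_diamond_hubs_bij_betw[OF bij_betw_trans[OF g f]]) (simp add: arcs)
  finally show ?thesis .
qed


section \<open>Copies of Hamming graphs, some of them switched\<close>

type_synonym vertex = "nat \<times> nat \<times> nat \<times> nat"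

definition hamming_vertices :: "nat \<Rightarrow> nat \<Rightarrow> vertex set" where
  "hamming_vertices m k = {..<m} \<times> {..<k} \<times> {..<4} \<times> {..<4}"

fun hamming :: "vertex \<Rightarrow> vertex \<Rightarrow> bool" where
  "hamming (c, t, a, b) (c', t', a', b') \<longleftrightarrow> c = c' \<and>
     (t \<noteq> t' \<and> a = a' \<and> b = b' \<or> t = t' \<and> a \<noteq> a' \<and> b = b' \<or> t = t' \<and> a = a' \<and> b \<noteq> b')"

text \<open>
  A vertex \<open>(c, t, a, b)\<close> lies in copy \<open>c\<close>, at vertex \<open>t\<close> of the complete graph and at the square
  \<open>(a, b)\<close> of the board. Copies \<open>c < i\<close> are switched: switching the rook's graph with respect to the
  diagonal \<open>a = b\<close> yields the Shrikhande graph.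
\<close>

fun switched :: "nat \<Rightarrow> vertex \<Rightarrow> vertex \<Rightarrow> bool" where
  "switched i (c, t, a, b) (c', t', a', b') \<longleftrightarrow>
     (if c = c' \<and> t = t' \<and> c < i \<and> (a = b) \<noteq> (a' = b') then a \<noteq> a' \<and> b \<noteq> b'
      else hamming (c, t, a, b) (c', t', a', b'))"

lemma switched_sym: "switched i x y \<longleftrightarrow> switched i y x"
  by (cases x; cases y) auto

lemma switched_irrefl: "\<not> switched i x x"
  by (cases x) auto

lemma switched_0: "switched 0 = hamming"
  by (intro ext) (auto simp: split_paired_all)

lemma switched_eq_hamming: "\<not> fst x < i \<Longrightarrow> switched i x y \<longleftrightarrow> hamming x y"
  by (cases x; cases y) simp

lemma hamming_fst: "hamming x y \<Longrightarrow> fst x = fst y"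
  by (cases x; cases y) simp

text \<open>Adjacent vertices differ in one coordinate. Adjacent neighbours of \<open>v\<close>
  differ from \<open>v\<close> in the same coordinate, so \<open>x\<close>, \<open>y\<close> and
  \<open>z\<close> all lie on one line through \<open>v\<close>, which is a clique.\<close>

lemma hamming_no_diamond:
  assumes "hamming v x" "hamming v y" "hamming v z" "hamming x y" "hamming y z" "x \<noteq> z"
  shows "hamming x z"
  using assms by (cases v; cases x; cases y; cases z) (simp, blast)

lemma isospectral_sym: "isospectral G H \<Longrightarrow> isospectral H G"
  and isospectral_trans: "isospectral G H \<Longrightarrow> isospectral H K \<Longrightarrow> isospectral G K"
  by (simp_all add: isospectral_def)

text \<open>The cells are the diagonals of the boards in copies below \<open>i\<close>, of size 4,
  whence \<open>h = 2\<close>. An off-diagonal square sees exactly two squares of its diagonal, and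
  switching exchanges them for the other two.\<close>

lemma isospectral_hamming_switched:
  assumes f: "bij_betw f {..<n} (hamming_vertices m k)"
  shows "isospectral (nat_graph f n hamming) (nat_graph f n (switched i))"
proof -
  define D where "D = {(c, t, a, b) \<in> hamming_vertices m k. c < i \<and> a = b}"
  define cell :: "vertex \<Rightarrow> vertex set" where "cell = (\<lambda>(c, t, a, b). (\<lambda>j. (c, t, j, j)) ` {..<4})"
  have card_sub: "card {u \<in> cell (c, t, a, b). P u} = card {j \<in> {..<4}. P (c, t, j, j)}" for c t a b P
  proof -
    have "{u \<in> cell (c, t, a, b). P u} = (\<lambda>j. (c, t, j, j)) ` {j \<in> {..<4}. P (c, t, j, j)}"
      by (auto simp: cell_def)
    then show ?thesis
      by (simp add: card_image inj_on_def)
  qed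
  show ?thesis
  proof (rule godsil_mckay_isospectral[OF f, where D = D and cell = cell and h = 2])
    show "D \<subseteq> hamming_vertices m k"
      by (auto simp: D_def)
    show "cell x \<subseteq> D" if "x \<in> D" for x
      using that by (auto simp: cell_def D_def hamming_vertices_def)
    show "y \<in> cell x \<longleftrightarrow> cell y = cell x" if xy: "x \<in> D" "y \<in> D" for x y
    proof -
      obtain c t a c' t' a' where x: "x = (c, t, a, a)" and y: "y = (c', t', a', a')" "a' < 4"
        using xy by (auto simp: D_def hamming_vertices_def)
      have "y \<in> cell x" if "cell y = cell x"
      proof -
        have "y \<in> cell y"
          using y by (auto simp: cell_def)
        then show ?thesis
          using that by simp
      qed
      then show ?thesis
        by (auto simp: x y cell_def)
    qed
    show "card (cell x) = 2 * 2" if "x \<in> D" for x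
      using that card_sub[of _ _ _ _ "\<lambda>_. True"] by (cases x) simp
    show "hamming x y \<longleftrightarrow> hamming y x" for x y
      using switched_sym[of 0] by (simp add: switched_0)
    show "switched i x y \<longleftrightarrow> switched i y x" for x y
      by (rule switched_sym)
    show "hamming x y \<longleftrightarrow> switched i x y"
      if "x \<in> hamming_vertices m k" "y \<in> hamming_vertices m k" "x \<in> D \<longleftrightarrow> y \<in> D" for x y
      using that by (cases x; cases y) (auto simp: D_def)
    show "card {u \<in> cell x. hamming u y} = 2 * (of_bool (hamming x y) + of_bool (switched i x y))"
      if "x \<in> D" "y \<in> hamming_vertices m k - D" for x y
    proof -
      obtain c t a where x: "x = (c, t, a, a)" "c < i"
        using \<open>x \<in> D\<close> by (auto simp: D_def)
      obtain c' t' a' b' where y: "y = (c', t', a', b')"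
        by (cases y)
      \<comment> \<open>In copies from \<open>i\<close> on, \<open>y\<close> may be a diagonal
        square, but then it lies in another copy than \<open>x\<close>.\<close>
      have y_less: "a' < 4" "b' < 4" and y_off: "c' < i \<Longrightarrow> a' \<noteq> b'"
        using that(2) by (auto simp: y D_def hamming_vertices_def)
      have "card {u \<in> cell x. hamming u y} = card {j \<in> {..<4}. hamming (c, t, j, j) y}"
        by (simp add: x card_sub)
      also have "{j \<in> {..<4}. hamming (c, t, j, j) y} = (if c = c' \<and> t = t' then {a', b'} else {})"
        using x y_less y_off by (auto simp: y)
      also have "card \<dots> = 2 * (of_bool (hamming x y) + of_bool (switched i x y))"
        using x y_off by (auto simp: y)
      finally show ?thesis .
    qed
    show "card {u \<in> cell x. hamming u y} = card {u \<in> cell y. hamming u x}" if xy: "x \<in> D" "y \<in> D" for x y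
    proof -
      obtain c t a c' t' a' where x: "x = (c, t, a, a)" "a < 4" and y: "y = (c', t', a', a')" "a' < 4"
        using xy by (auto simp: D_def hamming_vertices_def)
      \<comment> \<open>A diagonal is an independent set, and a diagonal square meets the diagonal
        of another board of its copy in one square. The condition is symmetric in the two
        boards.\<close>
      have *: "{j \<in> {..<4}. hamming (c, t, j, j) (c', t', a', a')} = (if c = c' \<and> t \<noteq> t' then {a'} else {})"
        if "a' < 4" for c t c' t' a'
        using that by auto
      show ?thesis
        unfolding x(1) y(1) card_sub *[OF x(2)] *[OF y(2)] by auto
    qed
  qed simp
qed

text \<open>There are \<open>k - 1\<close> neighbours on the other boards and 6 on the own board,
  switched or not.\<close>

lemma switched_degree:
  assumes "x \<in> hamming_vertices m k"
  shows "card {y \<in> hamming_vertices m k. switched i x y} = k + 5"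
proof -
  obtain c t a b where x: "x = (c, t, a, b)" and less: "c < m" "t < k" "a < 4" "b < 4"
    using assms by (auto simp: hamming_vertices_def)
  define S where "S = {p \<in> {..<4} \<times> {..<4}. switched i (c, t, a, b) (c, t, p)}"
  have split: "{y \<in> hamming_vertices m k. switched i x y} =
      (\<lambda>t'. (c, t', a, b)) ` ({..<k} - {t}) \<union> (\<lambda>p. (c, t, p)) ` S"
    using less by (auto simp: x S_def hamming_vertices_def split: if_splits)
  have "card S = 6"
  proof (cases "c < i")
    case False
    then have "S = {a} \<times> ({..<4} - {b}) \<union> ({..<4} - {a}) \<times> {b}"
      using less by (auto simp: S_def)
    also have "card \<dots> = 6"
      using less by (subst card_Un_disjoint) (auto simp: card_cartesian_product)
    finally show ?thesis .
  next
    case True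
    show ?thesis
    proof (cases "a = b")
      case True
      \<comment> \<open>A switched diagonal square sees the off-diagonal squares outside its row and
        column: three rows with two squares each.\<close>
      then have "S = (SIGMA p : {..<4} - {a}. {..<4} - {a, p})"
        using less \<open>c < i\<close> by (auto simp: S_def split: if_splits)
      also have "card \<dots> = (\<Sum>p\<in>{..<4} - {a}. card ({..<4} - {a, p}))"
        by simp
      also have "\<dots> = (\<Sum>p\<in>{..<4} - {a}. 2)"
        using less by (intro sum.cong refl) (simp add: card_Diff_subset)
      finally show ?thesis
        using less by simp
    next
      case False
      define R where "R = {..<4} - {a, b}"
      have R: "finite R" "card R = 2" "a \<notin> R" "b \<notin> R"
        using less False by (auto simp: R_def card_Diff_subset)
      \<comment> \<open>Two off-diagonal squares remain in the row and two in the column; the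
        diagonal squares \<open>(a, a)\<close> and \<open>(b, b)\<close> are traded for the other
        two.\<close>
      have "S = {a} \<times> R \<union> (R \<times> {b} \<union> (\<lambda>j. (j, j)) ` R)"
      proof -
        have "switched i (c, t, a, b) (c, t, p, q) \<longleftrightarrow>
            (if p = q then p \<noteq> a \<and> p \<noteq> b else p = a \<and> q \<noteq> b \<or> p \<noteq> a \<and> q = b)" for p q
          using False \<open>c < i\<close> by auto
        then show ?thesis
          using less False by (auto simp: S_def R_def split: if_splits simp del: switched.simps)
      qed
      also have "card \<dots> = card ({a} \<times> R) + (card (R \<times> {b}) + card ((\<lambda>j. (j, j)) ` R))"
        using R by (subst card_Un_disjoint; (subst card_Un_disjoint)?; auto)
      also have "\<dots> = 6"
        using R by (simp add: card_cartesian_product card_image inj_on_def)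
      finally show ?thesis .
    qed
  qed
  moreover have "finite S"
    by (auto simp: S_def)
  moreover have "(\<lambda>t'. (c, t', a, b)) ` ({..<k} - {t}) \<inter> (\<lambda>p. (c, t, p)) ` S = {}"
    by auto
  ultimately show ?thesis
    using less unfolding split by (simp add: card_Un_disjoint card_image inj_on_def)
qed

text \<open>The hubs are exactly the \<open>16 * k\<close> vertices of each switched copy.\<close>

lemma card_diamond_hubs_switched:
  assumes "i \<le> m"
  shows "card (diamond_hubs (hamming_vertices m k) (switched i)) = i * k * 16"
proof -
  let ?X = "hamming_vertices m k"
  have "diamond_hubs ?X (switched i) = hamming_vertices i k"
  proof (intro equalityI subsetI)
    fix v assume "v \<in> diamond_hubs ?X (switched i)"
    then obtain x y z where v: "v \<in> ?X"
      and E: "switched i v x" "switched i v y" "switched i v z" "switched i x y" "switched i y z"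
        "x \<noteq> z" "\<not> switched i x z"
      unfolding diamond_hubs_def by blast
    have "fst v < i"
    proof (rule ccontr)
      assume v: "\<not> fst v < i"
      then have "hamming v x" "hamming v y" "hamming v z"
        using E switched_eq_hamming by blast+
      \<comment> \<open>Edges stay within a copy, so the whole diamond would lie in an unswitched
        one.\<close>
      moreover from this v have "\<not> fst x < i" "\<not> fst y < i"
        using hamming_fst by metis+
      then have "hamming x y" "hamming y z" "\<not> hamming x z"
        using E switched_eq_hamming by blast+
      ultimately show False
        using hamming_no_diamond \<open>x \<noteq> z\<close> by blast
    qed
    then show "v \<in> hamming_vertices i k"
      using v by (auto simp: hamming_vertices_def)
  next
    fix v assume "v \<in> hamming_vertices i k"
    then obtain c t a b where v: "v = (c, t, a, b)" "c < i" "t < k" "a < 4" "b < 4"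
      by (auto simp: hamming_vertices_def)
    have X: "(c, t, a', b') \<in> ?X" if "a' < 4" "b' < 4" for a' b'
      using that v assms by (auto simp: hamming_vertices_def)
    obtain p q where pq: "p < 4" "q < 4" "p \<noteq> q" "p \<notin> {a, b}" "q \<notin> {a, b}"
    proof -
      have "card ({..<4} - {a, b}) \<ge> 2"
        using diff_card_le_card_Diff[of "{a, b}" "{..<4}"] card_insert_le_m1[of 2 "{b}" a] by force
      then show ?thesis
        using that by (auto simp: card_le_Suc_iff numeral_2_eq_2)
    qed
    show "v \<in> diamond_hubs ?X (switched i)"
    proof (cases "a = b")
      case True
      obtain s where s: "s < 4" "s \<notin> {a, p, q}"
      proof -
        have "card ({..<4} - {a, p, q}) = 1"
          using v True pq by (subst card_Diff_subset) auto
        then have "{..<4} - {a, p, q} \<noteq> {}"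
          by force
        then show ?thesis
          using that by blast
      qed
      show ?thesis
        \<comment> \<open>All three squares avoid row and column \<open>a\<close>, hence see
          \<open>(a, a)\<close> after switching; the outer two share no line.\<close>
        by (rule diamond_hubsI[of _ _ "(c, t, p, q)" "(c, t, p, s)" "(c, t, q, s)"])
          (use True v pq s in \<open>auto intro: X\<close>)
    next
      case False
      show ?thesis
        \<comment> \<open>Switching joins \<open>(p, p)\<close> to \<open>(a, b)\<close> and
          \<open>(a, q)\<close> but cuts it off from \<open>(a, p)\<close>, which shares its
          column.\<close>
        by (rule diamond_hubsI[of _ _ "(c, t, a, p)" "(c, t, a, q)" "(c, t, p, p)"])
          (use False v pq in \<open>auto intro: X\<close>)
    qed
  qed
  then show ?thesis
    by (simp add: hamming_vertices_def)
qed

lemma isospectral_regular_graphs: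
  assumes "r \<ge> 6"
  shows "\<exists>G :: nat \<Rightarrow> nat pair_pre_digraph.
           (\<forall>i<m. regular_graph r (G i)) \<and>
           (\<forall>i<m. \<forall>j<m. i \<noteq> j \<longrightarrow> isospectral (G i) (G j) \<and> \<not> isomorphic (G i) (G j))"
proof -
  \<comment> \<open>The degree is \<open>k + 5\<close>; \<open>r \<ge> 6\<close> makes
    \<open>k\<close> positive, so the hub counts \<open>i * k * 16\<close> are distinct for distinct
    \<open>i\<close>.\<close>
  define k where "k = r - 5"
  have k: "k > 0" "r = k + 5"
    using assms by (auto simp: k_def)
  let ?X = "hamming_vertices m k"
  have "finite ?X"
    by (simp add: hamming_vertices_def)
  then obtain f where "bij_betw f {0..<card ?X} ?X"
    using ex_bij_betw_nat_finite by blast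
  then obtain n where f: "bij_betw f {..<n} ?X"
    by (metis lessThan_atLeast0)
  show ?thesis
  proof (intro exI conjI allI impI)
    fix i assume "i < m"
    then have "(i, 0, 0, 0) \<in> ?X"
      using k by (simp add: hamming_vertices_def)
    then have "?X \<noteq> {}"
      by blast
    then show "regular_graph r (nat_graph f n (switched i))"
      by (intro regular_nat_graph[OF f]) (use switched_sym switched_irrefl switched_degree k in blast)+
  next
    fix i j :: nat
    show "isospectral (nat_graph f n (switched i)) (nat_graph f n (switched j))"
      using isospectral_hamming_switched[OF f] isospectral_sym isospectral_trans by blast
    assume "i < m" "j < m" "i \<noteq> j"
    then have "card (diamond_hubs ?X (switched i)) \<noteq> card (diamond_hubs ?X (switched j))"
      using k by (simp add: card_diamond_hubs_switched)
    then show "\<not> isomorphic (nat_graph f n (switched i)) (nat_graph f n (switched j))"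
      using isomorphic_nat_graph_card_diamond_hubs[OF f] by blast
  qed
qed


section \<open>Lower bounds on the degree\<close>

text \<open>The span of the \<open>0/1\<close>-vector \<open>\<chi> S\<close> determines its support
  \<open>S\<close>, so nonempty subsets of \<open>{..<d}\<close> inject into the lines.\<close>

lemma gaussian_binomial_1_ge:
  fixes F :: "'k ring"
  assumes "field F" "finite (carrier F)"
  shows "gaussian_binomial F d 1 \<ge> 2 ^ d - 1"
proof -
  interpret F: field F by fact
  define V where "V = coordinate_space F d"
  have V: "V = F.func_space {..<d}"
    by (simp add: V_def coordinate_space_def)
  interpret V: vectorspace F V
    unfolding V by (intro vectorspace.intro F.func_space_is_module F.field_axioms)
  define \<chi> where "\<chi> S = restrict (\<lambda>i. if i \<in> S then \<one>\<^bsub>F\<^esub> else \<zero>\<^bsub>F\<^esub>) {..<d}" for S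
  define lines where
    "lines = {W. VectorSpace.subspace F W V \<and> vectorspace.dim F (V\<lparr>carrier := W\<rparr>) = 1}"
  have carrier_V: "carrier V = {..<d} \<rightarrow>\<^sub>E carrier F"
    by (simp add: V F.func_space_def)
  have \<chi>: "\<chi> S \<in> carrier V" for S
    by (auto simp: carrier_V \<chi>_def)
  have "W \<subseteq> carrier V" if "W \<in> lines" for W
    using that by (auto simp: lines_def VectorSpace.subspace_def submodule_def)
  then have "lines \<subseteq> Pow (carrier V)"
    by blast
  moreover have "finite (carrier V)"
    unfolding carrier_V using assms(2) by (simp add: finite_PiE)
  ultimately have fin: "finite lines"
    using finite_subset by blast
  have span_mem: "\<exists>\<alpha>\<in>carrier F. w = \<alpha> \<odot>\<^bsub>V\<^esub> \<chi> S" if w: "w \<in> V.span {\<chi> S}" for w S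
  proof -
    have "V.span {\<chi> S} = {V.lincomb \<alpha> {\<chi> S} |\<alpha>. \<alpha> \<in> {\<chi> S} \<rightarrow> carrier F}"
      by (rule V.finite_span) (simp_all add: \<chi>)
    then obtain \<alpha> where \<alpha>: "w = V.lincomb \<alpha> {\<chi> S}" "\<alpha> \<in> {\<chi> S} \<rightarrow> carrier F"
      using w by blast
    then have "\<alpha> (\<chi> S) \<in> carrier F"
      by blast
    moreover from this have "w = \<alpha> (\<chi> S) \<odot>\<^bsub>V\<^esub> \<chi> S"
      unfolding \<alpha>(1) V.lincomb_def using \<chi> by simp
    ultimately show ?thesis
      by blast
  qed
  have mem_span: "\<chi> S \<in> V.span {\<chi> S}" for S
    using V.in_own_span[of "{\<chi> S}"] \<chi> by auto
  have sub: "T \<subseteq> S" if eq: "V.span {\<chi> T} = V.span {\<chi> S}" and T: "T \<subseteq> {..<d}" for S T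
  proof
    fix i assume i: "i \<in> T"
    obtain \<alpha> where \<alpha>: "\<alpha> \<in> carrier F" "\<chi> T = \<alpha> \<odot>\<^bsub>V\<^esub> \<chi> S"
      using span_mem[of "\<chi> T" S] mem_span[of T] eq by auto
    have "i < d"
      using i T by auto
    \<comment> \<open>Comparing coordinate \<open>i\<close> of \<open>\<chi> T\<close> and
      \<open>\<alpha>\<close> times \<open>\<chi> S\<close>: outside \<open>S\<close> this would
      read \<open>1 = 0\<close>.\<close>
    then have "\<one>\<^bsub>F\<^esub> = \<alpha> \<otimes>\<^bsub>F\<^esub> (if i \<in> S then \<one>\<^bsub>F\<^esub> else \<zero>\<^bsub>F\<^esub>)"
      using fun_cong[OF \<alpha>(2), of i] i by (simp add: V F.func_space_def \<chi>_def)
    then show "i \<in> S"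
      using \<alpha> by (auto split: if_splits)
  qed
  have "V.span {\<chi> S} \<in> lines" if S: "S \<subseteq> {..<d}" "S \<noteq> {}" for S
  proof -
    have subm: "submodule F (V.span {\<chi> S}) V"
      using V.span_is_submodule \<chi> by simp
    then have sub: "VectorSpace.subspace F (V.span {\<chi> S}) V"
      by (intro VectorSpace.subspace.intro V.vectorspace_axioms)
    then interpret W: vectorspace F "V.span_vs {\<chi> S}"
      by (rule V.subspace_is_vs)
    obtain i where i: "i \<in> S" "i < d"
      using S by auto
    have "\<chi> S i \<noteq> \<zero>\<^bsub>V\<^esub> i"
      using i by (simp add: \<chi>_def V F.func_space_def)
    then have "\<chi> S \<noteq> \<zero>\<^bsub>V\<^esub>"
      by metis
    then have "W.dim = 1"
      using mem_span V.span_li_not_depend(1)[of "{\<chi> S}", OF _ subm]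
      by (intro W.dim1I[of "\<chi> S"]) auto
    then show ?thesis
      using sub by (simp add: lines_def)
  qed
  then have "(\<lambda>S. V.span {\<chi> S}) ` (Pow {..<d} - {{}}) \<subseteq> lines"
    by blast
  moreover have "inj_on (\<lambda>S. V.span {\<chi> S}) (Pow {..<d} - {{}})"
    using sub by (intro inj_onI) (metis Diff_iff PowD subset_antisym)
  ultimately have "card (Pow {..<d} - {{}}) \<le> card lines"
    using fin by (metis card_inj_on_le)
  moreover have "card (Pow {..<d} - {{}}) = 2 ^ d - 1"
    by (simp add: card_Pow)
  ultimately show ?thesis
    by (simp add: gaussian_binomial_def lines_def V_def)
qed

text \<open>The quotient is a geometric sum of \<open>d\<close> terms, each at least 1.\<close>

lemma le_pow_minus_1_div:
  fixes q :: nat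
  assumes "q \<ge> 2"
  shows "d \<le> (q ^ d - 1) div (q - 1)"
proof -
  have "(q - 1) * d \<le> (q - 1) * (\<Sum>i<d. q ^ i)"
    using assms sum_mono[of "{..<d}" "\<lambda>_. 1" "\<lambda>i. q ^ i"] by (intro mult_le_mono2) auto
  also have "\<dots> = q ^ d - 1"
    using assms by (induction d) (auto simp: algebra_simps)
  finally show ?thesis
    using assms by (simp add: less_eq_div_iff_mult_less_eq mult.commute)
qed

theorem theorem2:
  fixes d q r m :: nat
  assumes "d \<ge> 3"
    and "primepow q"
    and "r = 2 * ((q ^ d - 1) div (q - 1)) \<or>
         (\<exists>F :: nat ring. field F \<and> order F = q \<and> r = (\<Sum>i = 1..d - 1. gaussian_binomial F d i))"
  shows "\<exists>G :: nat \<Rightarrow> nat pair_pre_digraph.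
           (\<forall>i<m. regular_graph r (G i)) \<and>
           (\<forall>i<m. \<forall>j<m. i \<noteq> j \<longrightarrow> isospectral (G i) (G j) \<and> \<not> isomorphic (G i) (G j))"
proof (rule isospectral_regular_graphs)
  have q: "q \<ge> 2"
    using primepow_gt_Suc_0[OF assms(2)] by simp
  from assms(3) show "r \<ge> 6"
  proof
    assume "r = 2 * ((q ^ d - 1) div (q - 1))"
    then show ?thesis
      using le_pow_minus_1_div[OF q, of d] assms(1) by simp
  next
    assume "\<exists>F :: nat ring. field F \<and> order F = q \<and> r = (\<Sum>i = 1..d - 1. gaussian_binomial F d i)"
    then obtain F :: "nat ring" where F: "field F" "order F = q"
      and r: "r = (\<Sum>i = 1..d - 1. gaussian_binomial F d i)"
      by blast
    \<comment> \<open>An infinite carrier would have \<open>card\<close> equal to 0, contradicting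
      \<open>q \<ge> 2\<close>.\<close>
    have "finite (carrier F)"
      using F q by (intro card_ge_0_finite) (simp add: Coset.order_def)
    have "(2 :: nat) ^ 3 \<le> 2 ^ d"
      using assms(1) by (intro power_increasing) auto
    then have "6 \<le> 2 ^ d - (1 :: nat)"
      by simp
    also have "\<dots> \<le> gaussian_binomial F d 1"
      by (rule gaussian_binomial_1_ge) fact+
    also have "\<dots> \<le> r"
      unfolding r using assms(1) by (intro member_le_sum) auto
    finally show ?thesis .
  qed
qed

end
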